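(* Let $f\in\mathcal{S}$ be given by $f(z)=z+a_2z^2+a_3z^3+\cdots$. Then $$|a_5|-|a_4|\le 2.3297\ldots.$$
   Context: $\mathcal{S}$ denotes the class of functions $f$ that are analytic and univalent (injective) in the open unit disk $\mathbb{D}=\{z\in\mathbb{C}:|z|<1\}$ and normalized so that $f(z)=z+\sum_{n=2}^\infty a_n z^n$; the numbers $a_n$ are the Taylor coefficients of $f$ at $0$. The bound is a numerical constant given by its truncated decimal expansion $2.3297\ldots$. *)

theory Defs
  imports "HOL-Complex_Analysis.Complex_Analysis"
begin

(* Only the values of f on the unit disk matter; f is an arbitrary total function outside it. *)
definition class_S :: "(complex \<Rightarrow> complex) set" where
  "class_S = {f. f holomorphic_on ball 0 1 \<and> inj_on f (ball 0 1) \<and> f 0 = 0 \<and> deriv f 0 = 1}"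

definition taylor_coeff :: "(complex \<Rightarrow> complex) \<Rightarrow> nat \<Rightarrow> complex" where
  "taylor_coeff f n = fps_nth (fps_expansion f 0) n"

end

theory Submission
  imports Defs
begin

text \<open>
  Write z / f(z) = g(z)^2 with g(0) = 1 and coefficients c_k of g. The square root transform
  of f gives an injective function G(z) = g(z^2) / z = 1/z + b_1 z + ... on the punctured disk, to which Gronwall's
  area theorem applies: |c_1|^2 + 3 |c_2|^2 + 5 |c_3|^2 + 7 |c_4|^2 \<le> 1. In particular
  |c_1| \<le> 1, so |a_5| - |a_4| \<le> |a_5 + c_1 a_4|, where the right-hand side is the
  modulus of a polynomial in c_1, ..., c_4. Bounding it termwise and maximising subject to the
  constraint of the area theorem gives 2.32970....

  For the area theorem no Green formula is needed: the image of the annulus s < |z| < r under G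
  lies inside the image of the circle |z| = s, which is an ellipse up to a small error. The
  real-linear map w \<mapsto> w - \<beta> cnj w with \<beta> = b_1 s^2 turns that ellipse into a disk
  of radius 1/s, so that comparing the area of the image with that of the disk and letting
  s \<rightarrow> 0 gives the sharp inequality.
\<close>

section \<open>Fourier coefficients and Bessel's inequality on circles\<close>

lemma has_integral_fourier_coeff:
  fixes f :: "complex \<Rightarrow> complex"
  assumes hol: "f holomorphic_on ball 0 R" and F: "f has_fps_expansion F" and r: "0 < r" "r < R"
  shows "((\<lambda>t. f (of_real r * cis t) * cis (- (real k * t))) has_integral of_real (2 * pi * r ^ k) * fps_nth F k) {0..2*pi}"
proof -
  have "F = fps_expansion f 0" using F by (simp add: fps_expansion_eqI)
  then have Fk: "(deriv ^^ k) f 0 / fact k = fps_nth F k" by (simp add: fps_expansion_def)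
  have sub: "cball 0 r \<subseteq> ball (0::complex) R" using r by auto
  have "((\<lambda>u. f u / (u - 0) ^ Suc k) has_contour_integral (2 * pi * \<i>) / fact k * (deriv ^^ k) f 0) (circlepath 0 r)"
    using r sub by (intro Cauchy_has_contour_integral_higher_derivative_circlepath
        holomorphic_on_imp_continuous_on holomorphic_on_subset[OF hol]) auto
  moreover have "(2 * pi * \<i>) / fact k * (deriv ^^ k) f 0 = 2 * pi * \<i> * fps_nth F k"
    by (simp flip: Fk)
  ultimately have "((\<lambda>u. f u / u ^ Suc k) has_contour_integral 2 * pi * \<i> * fps_nth F k) (part_circlepath 0 r 0 (2*pi))"
    by (simp add: circlepath_def)
  then have "((\<lambda>t. f (of_real r * cis t) / (of_real r * cis t) ^ Suc k * r * \<i> * cis t) has_integral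
      2 * pi * \<i> * fps_nth F k) {0..2*pi}"
    by (subst (asm) has_contour_integral_part_circlepath_iff) auto
  \<comment> \<open>On \<open>z = r cis t\<close> the Cauchy integrand is
    \<open>\<i> * f z * cis (- k t) / r ^ k\<close>; the factor \<open>r ^ k / \<i>\<close> leaves
    exactly the Fourier integrand.\<close>
  from has_integral_mult_right[OF this, of "of_real r ^ k / \<i>"]
  have "((\<lambda>t. of_real r ^ k / \<i> * (f (of_real r * cis t) / (of_real r * cis t) ^ Suc k * r * \<i> * cis t)) has_integral
      of_real r ^ k / \<i> * (2 * pi * \<i> * fps_nth F k)) {0..2*pi}" .
  moreover have "of_real r ^ k / \<i> * (f (of_real r * cis t) / (of_real r * cis t) ^ Suc k * r * \<i> * cis t)
       = f (of_real r * cis t) * cis (- (real k * t))" for t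
  proof -
    have cancel: "a / j * (A / (q * x * (a * b)) * q * j * x) = A * (1 / b)"
      if "a \<noteq> 0" "b \<noteq> 0" "q \<noteq> 0" "x \<noteq> 0" "j \<noteq> 0" for a b q x j A :: complex
      using that by simp
    have "cis (- (real k * t)) = 1 / cis t ^ k"
      by (simp only: Complex.DeMoivre cis_inverse[symmetric] inverse_eq_divide)
    then show ?thesis
      using r by (simp only: power_Suc power_mult_distrib) (rule cancel, auto)
  qed
  moreover have "of_real r ^ k / \<i> * (2 * pi * \<i> * fps_nth F k) = of_real (2 * pi * r ^ k) * fps_nth F k"
  proof -
    have "a / j * (p * j * c) = p * a * c" if "j \<noteq> 0" for a j p c :: complex
      using that by simp
    from this[of \<i>, OF complex_i_not_zero] show ?thesis by (simp only: of_real_mult of_real_power)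
  qed
  ultimately show ?thesis by (simp only:)
qed

text \<open>With \<open>T\<close> the Taylor polynomial of degree \<open>M\<close>, the integrals of
  \<open>Re (f * cnj T)\<close> and of \<open>|T|^2\<close> over the circle both equal the left-hand
  side \<open>S\<close>. Integrating \<open>0 \<le> |f - T|^2\<close> then gives
  \<open>2 S - S \<le>\<close> the integral of \<open>|f|^2\<close>.\<close>

lemma Bessel_circle:
  fixes f :: "complex \<Rightarrow> complex"
  assumes hol: "f holomorphic_on ball 0 R" and F: "f has_fps_expansion F" and r: "0 < r" "r < R"
  shows "2 * pi * (\<Sum>k\<le>M. (cmod (fps_nth F k))\<^sup>2 * r ^ (2*k)) \<le> integral {0..2*pi} (\<lambda>t. (cmod (f (of_real r * cis t)))\<^sup>2)"
proof -
  define T where "T z = (\<Sum>k\<le>M. fps_nth F k * z ^ k)" for z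
  define S where "S = 2 * pi * (\<Sum>k\<le>M. (cmod (fps_nth F k))\<^sup>2 * r ^ (2*k))"
  have cT: "cnj (T (of_real r * cis t)) = (\<Sum>k\<le>M. cnj (fps_nth F k) * of_real (r ^ k) * cis (- (real k * t)))" for t
    unfolding T_def cnj_sum
    by (intro sum.cong refl) (simp add: power_mult_distrib cis_cnj Complex.DeMoivre[of "- t" for t])
  \<comment> \<open>Only the coefficients up to \<open>M\<close> of \<open>g\<close> enter, so this
    one computation serves both \<open>g = T\<close> and \<open>g = f\<close>.\<close>
  have *: "((\<lambda>t. Re (g (of_real r * cis t) * cnj (T (of_real r * cis t)))) has_integral S) {0..2*pi}"
    if "g holomorphic_on ball 0 R" "g has_fps_expansion G" "\<And>k. k \<le> M \<Longrightarrow> fps_nth G k = fps_nth F k" for g G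
  proof -
    have "((\<lambda>t. \<Sum>k\<le>M. cnj (fps_nth F k) * of_real (r ^ k) * (g (of_real r * cis t) * cis (- (real k * t))))
       has_integral (\<Sum>k\<le>M. cnj (fps_nth F k) * of_real (r ^ k) * (of_real (2 * pi * r ^ k) * fps_nth G k))) {0..2*pi}"
      by (intro has_integral_sum[OF finite_atMost] has_integral_mult_right has_integral_fourier_coeff[OF that(1,2) r])
    moreover have "(\<Sum>k\<le>M. cnj (fps_nth F k) * of_real (r ^ k) * (of_real (2 * pi * r ^ k) * fps_nth G k)) = of_real S"
      unfolding S_def sum_distrib_left of_real_sum
    proof (intro sum.cong refl)
      fix k assume "k \<in> {..M}"
      then have "cnj (fps_nth F k) * of_real (r ^ k) * (of_real (2 * pi * r ^ k) * fps_nth G k)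
          = (fps_nth F k * cnj (fps_nth F k)) * of_real (r ^ k * (2 * pi * r ^ k))"
        using that(3)[of k] by simp
      also have "\<dots> = of_real ((cmod (fps_nth F k))\<^sup>2 * (r ^ k * (2 * pi * r ^ k)))"
        by (simp only: of_real_mult of_real_power complex_norm_square[symmetric])
      also have "(cmod (fps_nth F k))\<^sup>2 * (r ^ k * (2 * pi * r ^ k)) = 2 * pi * ((cmod (fps_nth F k))\<^sup>2 * r ^ (2*k))"
        using power_add[of r k k] by (simp add: mult_2[of k])
      finally show "cnj (fps_nth F k) * of_real (r ^ k) * (of_real (2 * pi * r ^ k) * fps_nth G k)
        = of_real (2 * pi * ((cmod (fps_nth F k))\<^sup>2 * r ^ (2*k)))" .
    qed
    moreover have "(\<lambda>t. \<Sum>k\<le>M. cnj (fps_nth F k) * of_real (r ^ k) * (g (of_real r * cis t) * cis (- (real k * t))))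
       = (\<lambda>t. g (of_real r * cis t) * cnj (T (of_real r * cis t)))"
      unfolding cT sum_distrib_left by (intro ext sum.cong refl) simp
    ultimately have "((\<lambda>t. g (of_real r * cis t) * cnj (T (of_real r * cis t))) has_integral of_real S) {0..2*pi}"
      by (simp only:)
    from has_integral_Re[OF this] show ?thesis by simp
  qed
  have "T has_fps_expansion (\<Sum>k\<le>M. fps_const (fps_nth F k) * fps_X ^ k)"
    unfolding T_def by (intro fps_expansion_intros)
  moreover have "T holomorphic_on ball 0 R" unfolding T_def by (intro holomorphic_intros)
  moreover have "fps_nth (\<Sum>k\<le>M. fps_const (fps_nth F k) * fps_X ^ k) j = fps_nth F j" if "j \<le> M" for j
    using that by (simp add: fps_sum_nth if_distrib cong: if_cong)
  ultimately have T: "((\<lambda>t. Re (T (of_real r * cis t) * cnj (T (of_real r * cis t)))) has_integral S) {0..2*pi}"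
    by (intro *)
  have f: "((\<lambda>t. Re (f (of_real r * cis t) * cnj (T (of_real r * cis t)))) has_integral S) {0..2*pi}"
    by (rule *[OF hol F refl])
  have lo: "((\<lambda>t. 2 * Re (f (of_real r * cis t) * cnj (T (of_real r * cis t))) - Re (T (of_real r * cis t) * cnj (T (of_real r * cis t))))
        has_integral 2 * S - S) {0..2*pi}"
    by (intro has_integral_diff has_integral_mult_right f T)
  have int: "(\<lambda>t. (cmod (f (of_real r * cis t)))\<^sup>2) integrable_on {0..2*pi}"
  proof (rule integrable_continuous_real)
    have "continuous_on {0..2*pi} (\<lambda>t. f (of_real r * cis t))"
      by (rule continuous_on_compose2[OF holomorphic_on_imp_continuous_on[OF hol]])
        (use r in \<open>auto intro!: continuous_intros simp: norm_mult\<close>)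
    then show "continuous_on {0..2*pi} (\<lambda>t. (cmod (f (of_real r * cis t)))\<^sup>2)"
      by (intro continuous_intros)
  qed
  have pw: "2 * Re (f z * cnj (T z)) - Re (T z * cnj (T z)) \<le> (cmod (f z))\<^sup>2" for z
  proof -
    have "0 \<le> (cmod (f z - T z))\<^sup>2" by simp
    also have "\<dots> = (cmod (f z))\<^sup>2 - 2 * Re (f z * cnj (T z)) + Re (T z * cnj (T z))"
      unfolding cmod_power2 by (simp add: power2_eq_square algebra_simps)
    finally show ?thesis by simp
  qed
  have "2 * S - S \<le> integral {0..2*pi} (\<lambda>t. (cmod (f (of_real r * cis t)))\<^sup>2)"
    by (rule has_integral_le[OF lo integrable_integral[OF int]]) (rule pw)
  then show ?thesis by (simp add: S_def)
qed

section \<open>Location of the image of an annulus under an injective \<open>h z / z\<close>\<close>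

text \<open>If the value \<open>w0\<close> at \<open>z0\<close> lay outside the half-plane,
  injectivity would keep \<open>h z / z - w0\<close> free of zeros for
  \<open>0 < |z| < |z0|\<close>. The pole at 0 becomes a zero of the reciprocal, which is thus
  holomorphic in the whole disk, and the maximum principle for its exponential is violated at
  0.\<close>

lemma annulus_image_in_halfplane:
  assumes hol: "h holomorphic_on ball 0 1" and h0: "h 0 \<noteq> 0"
    and inj: "inj_on (\<lambda>z. h z / z) (ball 0 1 - {0})"
    and s: "0 < s" "s < cmod z0" "cmod z0 < 1"
    and circ: "\<And>z. cmod z = s \<Longrightarrow> Re (\<alpha> * (h z / z)) < B"
  shows "Re (\<alpha> * (h z0 / z0)) < B"
proof (rule ccontr)
  assume contra: "\<not> ?thesis"
  define w0 where "w0 = h z0 / z0"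
  have neg: "Re (\<alpha> * (h z / z - w0)) < 0" if "cmod z = s" for z
    using circ[OF that] contra by (simp add: w0_def algebra_simps)
  have "z0 \<noteq> 0" using s by auto
  have "\<alpha> \<noteq> 0" using neg[of "of_real s"] s by auto
  have nz: "\<alpha> * (h z - w0 * z) \<noteq> 0" if "cmod z < cmod z0" for z
  proof (cases "z = 0")
    case False
    have "h z / z \<noteq> w0"
      using inj_onD[OF inj, of z z0] that False s \<open>z0 \<noteq> 0\<close> by (auto simp: w0_def)
    then show ?thesis using \<open>\<alpha> \<noteq> 0\<close> False by (auto simp: field_simps)
  qed (use h0 \<open>\<alpha> \<noteq> 0\<close> in auto)
  \<comment> \<open>q is 1 / (\<alpha> (G - w0)) for G = h / z, so Re q is negative on the circle but vanishes at 0.\<close>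
  define q where "q z = z / (\<alpha> * (h z - w0 * z))" for z
  have "q holomorphic_on ball 0 (cmod z0)"
    unfolding q_def using nz s
    by (intro holomorphic_intros holomorphic_on_subset[OF hol]) auto
  then have eq: "(\<lambda>z. exp (q z)) holomorphic_on ball 0 (cmod z0)"
    by (intro holomorphic_intros)
  have lt1: "cmod (exp (q z)) < 1" if "z \<in> sphere 0 s" for z
  proof -
    have "z \<noteq> 0" "cmod z = s" using that s by auto
    then have "q z = 1 / (\<alpha> * (h z / z - w0))"
      by (simp add: q_def divide_simps)
    moreover have "Re (1 / x) < 0" if "Re x < 0" for x
      using that by (auto simp: Re_divide divide_less_0_iff sum_power2_gt_zero_iff)
    ultimately have "Re (q z) < 0" using neg[OF \<open>cmod z = s\<close>] by simp
    then show ?thesis by simp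
  qed
  have "compact (sphere (0::complex) s)" "sphere (0::complex) s \<noteq> {}" using s by auto
  moreover have "continuous_on (sphere 0 s) (\<lambda>z. cmod (exp (q z)))"
    using s by (intro continuous_intros continuous_on_subset[OF holomorphic_on_imp_continuous_on[OF eq]]) auto
  ultimately obtain z1 where z1: "z1 \<in> sphere 0 s" "\<And>z. z \<in> sphere 0 s \<Longrightarrow> cmod (exp (q z)) \<le> cmod (exp (q z1))"
    using continuous_attains_sup by metis
  have "cmod (exp (q 0)) \<le> cmod (exp (q z1))"
  proof (rule maximum_modulus_frontier[of "\<lambda>z. exp (q z)" "ball 0 s"])
    show "(\<lambda>z. exp (q z)) holomorphic_on interior (ball 0 s)"
      using s by (intro holomorphic_on_subset[OF eq]) auto
    show "continuous_on (closure (ball 0 s)) (\<lambda>z. exp (q z))"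
      using s by (intro continuous_on_subset[OF holomorphic_on_imp_continuous_on[OF eq]]) auto
    show "cmod (exp (q z)) \<le> cmod (exp (q z1))" if "z \<in> frontier (ball 0 s)" for z
      using that z1(2) s by simp
  qed (use s in auto)
  with lt1[OF z1(1)] show False by (simp add: q_def)
qed

text \<open>A disk is an intersection of half-planes, and the twist
  \<open>w \<mapsto> w - \<beta> cnj w\<close> is real-linear, so it pulls half-planes back to
  half-planes. For a twisted value \<open>u\<close> outside the disk, the half-plane with normal
  direction \<open>u\<close> contains the image of the circle but not that of \<open>z0\<close>,
  contradicting the half-plane version.\<close>

lemma annulus_image_in_ellipse:
  assumes hol: "h holomorphic_on ball 0 1" and h0: "h 0 \<noteq> 0"
    and inj: "inj_on (\<lambda>z. h z / z) (ball 0 1 - {0})"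
    and s: "0 < s" "s < cmod z0" "cmod z0 < 1"
    and circ: "\<And>z. cmod z = s \<Longrightarrow> cmod (h z / z - \<beta> * cnj (h z / z)) \<le> R"
  shows "cmod (h z0 / z0 - \<beta> * cnj (h z0 / z0)) \<le> R"
proof (rule ccontr)
  assume contra: "\<not> ?thesis"
  define u where "u = h z0 / z0 - \<beta> * cnj (h z0 / z0)"
  have u: "R < cmod u" using contra by (simp add: u_def)
  have Re: "Re ((cnj u - u * cnj \<beta>) * w) = Re (cnj u * (w - \<beta> * cnj w))" for w
    by (simp add: algebra_simps)
  have "R \<ge> 0" using circ[of "of_real s"] s by (auto intro: order_trans[OF norm_ge_zero])
  with u have "u \<noteq> 0" by auto
  have "Re ((cnj u - u * cnj \<beta>) * (h z0 / z0)) < (cmod u)\<^sup>2"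
  proof (rule annulus_image_in_halfplane[OF hol h0 inj s])
    fix z assume z: "cmod z = s"
    have "Re (cnj u * (h z / z - \<beta> * cnj (h z / z))) \<le> cmod u * cmod (h z / z - \<beta> * cnj (h z / z))"
      by (metis complex_Re_le_cmod complex_mod_cnj norm_mult)
    also have "\<dots> \<le> cmod u * R" using circ[OF z] by (intro mult_left_mono) auto
    also have "\<dots> < (cmod u)\<^sup>2" using u \<open>u \<noteq> 0\<close> by (simp add: power2_eq_square)
    finally show "Re ((cnj u - u * cnj \<beta>) * (h z / z)) < (cmod u)\<^sup>2" by (simp only: Re)
  qed
  then have "Re (cnj u * u) < (cmod u)\<^sup>2" by (simp only: Re flip: u_def)
  then show False by (simp add: cmod_power2) (simp add: power2_eq_square)
qed

text \<open>Here \<open>h z / z = 1/z + b z + O(z^2)\<close>, the absent constant term centring the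
  ellipse at 0. On \<open>|z| = s\<close> one has \<open>s^2 cnj (1/z) = z\<close>, so the twist by
  \<open>b s^2\<close> cancels \<open>b z\<close> exactly. A plain triangle inequality would give
  radius \<open>1/s + |b| s\<close>, whose square exceeds \<open>1/s^2\<close> by
  \<open>2 |b|\<close> even in the limit.\<close>

lemma circle_image_bound:
  assumes F: "h has_fps_expansion H" and H: "fps_nth H 0 = 1" "fps_nth H 1 = 0"
  obtains C \<delta> where "0 < \<delta>" 
    "\<And>z. 0 < cmod z \<Longrightarrow> cmod z < \<delta> \<Longrightarrow>
       cmod (h z / z - fps_nth H 2 * (cmod z)\<^sup>2 * cnj (h z / z)) \<le> 1 / cmod z + C * (cmod z)\<^sup>2"
proof -
  define b where "b = fps_nth H 2"
  \<comment> \<open>\<open>K\<close> collects the coefficients from index 3 on, so that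
    \<open>h z = 1 + b z^2 + z^3 k z\<close> near 0 with \<open>k\<close> bounded there.\<close>
  define K where "K = fps_shift 3 H"
  define k where "k = eval_fps K"
  have K: "k has_fps_expansion K"
    using F unfolding k_def K_def
    by (intro eval_fps_has_fps_expansion) (auto simp: has_fps_expansion_def fps_conv_radius_shift)
  have "(\<lambda>z. 1 + b * z^2 + z^3 * k z) has_fps_expansion 1 + fps_const b * fps_X^2 + fps_X^3 * K"
    by (intro fps_expansion_intros K)
  also have "1 + fps_const b * fps_X^2 + fps_X^3 * K = H"
  proof (rule fps_ext)
    fix n show "fps_nth (1 + fps_const b * fps_X^2 + fps_X^3 * K) n = fps_nth H n"
      using H by (cases "n = 0 \<or> n = 1 \<or> n = 2")
        (auto simp: K_def b_def fps_X_power_mult_nth)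
  qed
  finally have "eventually (\<lambda>z. h z = 1 + b * z^2 + z^3 * k z) (nhds 0)"
    using F unfolding has_fps_expansion_def by (auto elim: eventually_elim2)
  moreover have "eventually (\<lambda>z. cmod (k z) < cmod (k 0) + 1) (nhds 0)"
    using has_fps_expansion_imp_continuous[OF K, of UNIV]
    by (intro order_tendstoD(2)[of _ "cmod (k 0)"] tendsto_norm) (auto simp: continuous_at tendsto_nhds_iff)
  ultimately have ev: "eventually (\<lambda>z. cmod (h z - (1 + b * z^2)) \<le> (cmod (k 0) + 1) * cmod z ^ 3) (nhds 0)"
    
  proof eventually_elim
    case (elim z)
    then have "cmod (h z - (1 + b * z^2)) = cmod z ^ 3 * cmod (k z)" by (simp add: norm_mult norm_power)
    also have "\<dots> \<le> cmod z ^ 3 * (cmod (k 0) + 1)" using elim by (intro mult_left_mono) auto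
    finally show ?case by (simp add: mult.commute)
  qed
  obtain M e where e: "0 < e" "\<And>z. cmod z < e \<Longrightarrow> cmod (h z - (1 + b * z^2)) \<le> M * cmod z ^ 3"
  proof -
    from ev obtain d where "d > 0" "\<And>z. dist z 0 < d \<Longrightarrow> cmod (h z - (1 + b * z^2)) \<le> (cmod (k 0) + 1) * cmod z ^ 3"
      unfolding eventually_nhds_metric by blast
    then show thesis by (intro that[of d "cmod (k 0) + 1"]) auto
  qed
  define \<delta> where "\<delta> = min e 1"
  \<comment> \<open>The three summands bound what survives the cancellation: \<open>E\<close>, the
    twist of \<open>b z\<close> and the twist of \<open>E\<close>. Since
    \<open>\<delta> \<le> 1\<close>, higher powers of \<open>s\<close> are absorbed into
    \<open>s^2\<close>.\<close>
  define C where "C = M + cmod b ^ 2 + cmod b * M"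
  show thesis
  proof
    show "0 < \<delta>" using e by (simp add: \<delta>_def)
    fix z assume z: "0 < cmod z" "cmod z < \<delta>"
    define s where "s = cmod z"
    define E where "E = (h z - (1 + b * z^2)) / z"
    have s: "0 < s" "s < 1" "s < e" using z by (auto simp: s_def \<delta>_def)
    have "cmod (h z - (1 + b * z^2)) \<le> M * s ^ 3" using e(2)[of z] s by (simp add: s_def)
    then have E: "cmod E \<le> M * s^2"
      using s by (simp add: E_def norm_divide s_def[symmetric] divide_le_eq power3_eq_cube power2_eq_square mult_ac)
    then have "0 \<le> M * s^2" using norm_ge_zero order_trans by blast
    then have M: "M \<ge> 0" using s by (simp add: zero_le_mult_iff)
    have G: "h z / z = 1/z + b * z + E" using z by (simp add: E_def field_simps power2_eq_square)
    have s2: "of_real (s^2) * cnj (1/z) = z" using z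
      by (simp add: s_def divide_simps complex_norm_square del: of_real_power)
    have "h z / z - b * (cmod z)^2 * cnj (h z / z) 
       = 1/z + b*z + E - b * (of_real (s^2) * cnj (1/z)) - b * s^2 * cnj b * cnj z - b * s^2 * cnj E"
      unfolding G s_def[symmetric] by (simp add: algebra_simps)
    also have "\<dots> = 1/z + E - b * s^2 * cnj b * cnj z - b * s^2 * cnj E"
      unfolding s2 by simp
    also have "cmod \<dots> \<le> cmod (1/z) + cmod E + cmod (b * s^2 * cnj b * cnj z) + cmod (b * s^2 * cnj E)"
      by (intro order_trans[OF norm_triangle_ineq4] add_mono order_trans[OF norm_triangle_ineq]) auto
    also have "\<dots> = 1/s + cmod E + (cmod b)^2 * s^2 * s + cmod b * s^2 * cmod E"
      by (simp add: norm_mult norm_divide norm_power s_def power2_eq_square)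
    also have "\<dots> \<le> 1/s + M * s^2 + (cmod b)^2 * s^2 * 1 + cmod b * 1 * (M * s^2)"
      using E s M by (intro add_mono mult_mono order_refl mult_nonneg_nonneg) (auto simp: power_le_one)
    also have "\<dots> = 1/s + C * s^2" by (simp add: C_def algebra_simps)
    finally show "cmod (h z / z - fps_nth H 2 * (cmod z)\<^sup>2 * cnj (h z / z)) \<le> 1 / cmod z + C * (cmod z)\<^sup>2"
      by (simp add: b_def s_def)
  qed
qed

section \<open>Area of the twisted image of a rectangle\<close>

text \<open>Change of variables produces an integral over \<open>real^2\<close>, whereas Fubini
  applies on \<open>real \<times> real\<close>. The coordinate map between them sends boxes to boxes
  of the same content, so it transports the integral.\<close>

lemma integral_real2_iterated:
  fixes f :: "real^2 \<Rightarrow> 'a::banach"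
  assumes "continuous_on (cbox a b) f"
  shows "integral (cbox a b) f = integral {a$1..b$1} (\<lambda>x. integral {a$2..b$2} (\<lambda>y. f (vector [x, y])))"
proof -
  define g :: "real \<times> real \<Rightarrow> real^2" where "g = (\<lambda>(x, y). vector [x, y])"
  define h :: "real^2 \<Rightarrow> real \<times> real" where "h = (\<lambda>v. (v$1, v$2))"
  have hg: "h (g x) = x" and gh: "g (h v) = v" for x v
    by (auto simp: g_def h_def vec_eq_iff forall_2 split: prod.split)
  have g_alt: "g = (\<lambda>p. fst p *\<^sub>R axis 1 1 + snd p *\<^sub>R axis 2 1)"
    by (auto simp: g_def vec_eq_iff forall_2 axis_def)
  have gbox: "g ` cbox u v = cbox (g u) (g v)" for u v
  proof -
    have "x \<in> g ` cbox u v \<longleftrightarrow> h x \<in> cbox u v" for x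
      using gh hg by (metis imageE imageI)
    moreover have "h x \<in> cbox u v \<longleftrightarrow> x \<in> cbox (g u) (g v)" for x
      by (cases u; cases v) (auto simp: h_def g_def mem_box_cart forall_2 cbox_Pair_eq)
    ultimately show ?thesis by blast
  qed
  have hbox: "h ` cbox u v = cbox (h u) (h v)" for u v
    using gbox[of "h u" "h v"] by (metis (no_types, lifting) gh hg image_cong image_ident image_image)
  have cont: "measure lborel (g ` cbox u v) = 1 * measure lborel (cbox u v)" for u v
  proof -
    obtain u1 u2 v1 v2 where uv: "u = (u1,u2)" "v = (v1,v2)" by (cases u; cases v)
    have ex_2: "(\<exists>i::2. P i) \<longleftrightarrow> P 1 \<or> P 2" for P by (metis exhaust_2)
    show ?thesis unfolding gbox uv
      by (auto simp: content_cbox_if_cart content_Pair g_def UNIV_2 interval_eq_empty_cart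
content_real_if ex_2)
  qed
  have "(f has_integral integral (cbox a b) f) (cbox a b)"
    using assms integrable_continuous integrable_integral by blast
  then have "((\<lambda>x. f (g x)) has_integral (1/1) *\<^sub>R integral (cbox a b) f) (h ` cbox a b)"
  proof (intro has_integral_twiddle hg gh cont)
    show "continuous (at x) g" for x unfolding g_alt by (intro continuous_intros)
    show "\<exists>w z. g ` cbox u v = cbox w z" for u v using gbox by blast
    show "\<exists>w z. h ` cbox u v = cbox w z" for u v using hbox by blast
  qed auto
  then have "integral (cbox a b) f = integral (cbox (h a) (h b)) (\<lambda>x. f (g x))"
    unfolding hbox by (simp add: integral_unique)
  also have "\<dots> = integral (cbox (a$1) (b$1)) (\<lambda>x. integral (cbox (a$2) (b$2)) (\<lambda>y. f (g (x, y))))"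
    unfolding h_def
  proof (rule integral_prod_continuous)
    show "continuous_on (cbox (a $ 1, a $ 2) (b $ 1, b $ 2)) (\<lambda>x. f (g x))"
    proof (rule continuous_on_compose2[OF assms])
      show "continuous_on (cbox (a $ 1, a $ 2) (b $ 1, b $ 2)) g" unfolding g_alt by (intro continuous_intros)
      show "g ` cbox (a $ 1, a $ 2) (b $ 1, b $ 2) \<subseteq> cbox a b"
        using gbox[of "h a" "h b"] by (simp add: gh) (simp add: h_def)
    qed
  qed
  finally show ?thesis by (simp add: g_def)
qed
text \<open>\<open>L\<close> is multiplication by \<open>D\<close>, of determinant
  \<open>|D|^2\<close>, followed by the twist, of determinant
  \<open>1 - |\<beta>|^2\<close>.\<close>

lemma det_conformal_twist:
  fixes D \<beta> :: complex
  defines "L \<equiv> (\<lambda>h::real^2. let w = D * Complex (h$1) (h$2); u = w - \<beta> * cnj w in vector [Re u, Im u] :: real^2)"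
  shows "det (matrix L) = (1 - (cmod \<beta>)^2) * (cmod D)^2"
  unfolding det_2 matrix_def L_def Let_def cmod_power2
  by (simp add: axis_def algebra_simps power2_eq_square)

text \<open>The twisted image of the open rectangle lies in a disk of radius \<open>R\<close>, and
  its area is the integral of the Jacobian. Injectivity is asked for on the open rectangle only,
  because the later use with \<open>exp\<close> identifies the two horizontal edges.\<close>

lemma measure_twisted_image:
  fixes g :: "complex \<Rightarrow> complex" and a b :: "real^2" and \<beta> :: complex
  assumes der: "\<And>z. z \<in> {z. a$1 \<le> Re z \<and> Re z \<le> b$1 \<and> a$2 \<le> Im z \<and> Im z \<le> b$2} \<Longrightarrow> (g has_field_derivative g' z) (at z)"
  and cont: "continuous_on {z. a$1 \<le> Re z \<and> Re z \<le> b$1 \<and> a$2 \<le> Im z \<and> Im z \<le> b$2} g'"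
  and inj: "inj_on g {z. a$1 < Re z \<and> Re z < b$1 \<and> a$2 < Im z \<and> Im z < b$2}"
  and beta: "cmod \<beta> < 1"
  and bound: "\<And>z. z \<in> {z. a$1 < Re z \<and> Re z < b$1 \<and> a$2 < Im z \<and> Im z < b$2} \<Longrightarrow> cmod (g z - \<beta> * cnj (g z)) \<le> R"
  and R: "0 \<le> R"
  shows "(1 - (cmod \<beta>)^2) * integral {a$1..b$1} (\<lambda>x. integral {a$2..b$2} (\<lambda>y. (cmod (g' (Complex x y)))^2)) \<le> pi * R^2"
proof -
  define e :: "real^2 \<Rightarrow> complex" where "e v = Complex (v$1) (v$2)" for v
  define e' :: "complex \<Rightarrow> real^2" where "e' z = vector [Re z, Im z]" for z
  define T where "T w = w - \<beta> * cnj w" for w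
  define f where "f v = e' (T (g (e v)))" for v
  define f' where "f' v h = e' (T (g' (e v) * e h))" for v h
  have e: "bounded_linear e"
    unfolding e_def linear_conv_bounded_linear[symmetric] by (auto intro!: linearI simp: complex_eq_iff)
  have e': "bounded_linear e'"
    unfolding e'_def linear_conv_bounded_linear[symmetric] by (auto intro!: linearI simp: vec_eq_iff forall_2)
  have T: "bounded_linear T"
    unfolding T_def linear_conv_bounded_linear[symmetric] by (auto intro!: linearI simp: algebra_simps scaleR_conv_of_real)
  have box: "v \<in> box a b \<longleftrightarrow> a$1 < v$1 \<and> v$1 < b$1 \<and> a$2 < v$2 \<and> v$2 < b$2" for v
    by (auto simp: mem_box_cart forall_2)
  have cbox: "v \<in> cbox a b \<longleftrightarrow> a$1 \<le> v$1 \<and> v$1 \<le> b$1 \<and> a$2 \<le> v$2 \<and> v$2 \<le> b$2" for v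
    by (auto simp: mem_box_cart forall_2)
  have der_f: "(f has_derivative f' v) (at v within box a b)" if "v \<in> box a b" for v
  proof -
    have "(g has_derivative (*) (g' (e v))) (at (e v))"
      using der[of "e v"] that by (auto simp: box e_def has_field_derivative_def)
    then have "((\<lambda>v. g (e v)) has_derivative (\<lambda>h. g' (e v) * e h)) (at v)"
      by (rule has_derivative_compose[OF bounded_linear_imp_has_derivative[OF e]])
    then have "(f has_derivative f' v) (at v)"
      unfolding f_def f'_def
      by (intro bounded_linear.has_derivative[OF e'] bounded_linear.has_derivative[OF T])
    then show ?thesis by (rule has_derivative_at_withinI)
  qed
  \<comment> \<open>Conjugation preserves the modulus, so \<open>|\<beta>| < 1\<close> makes the
    twist injective.\<close>
  have T_inj: "x = y" if "T x = T y" for x y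
  proof -
    have "x - y = \<beta> * cnj (x - y)" using that by (simp add: T_def algebra_simps)
    then have "cmod (x - y) = cmod \<beta> * cmod (x - y)" by (metis complex_mod_cnj norm_mult)
    then show ?thesis using beta by auto
  qed
  have e'_inj: "x = y" if "e' x = e' y" for x y
    using that by (simp add: e'_def vec_eq_iff forall_2 complex_eq_iff)
  have "inj_on f (box a b)"
  proof (rule inj_onI)
    fix x y assume xy: "x \<in> box a b" "y \<in> box a b" "f x = f y"
    then have "g (e x) = g (e y)" unfolding f_def by (blast dest: T_inj e'_inj)
    then have "e x = e y" using inj_onD[OF inj, of "e x" "e y"] xy by (auto simp: box e_def)
    then show "x = y" by (simp add: e_def vec_eq_iff forall_2)
  qed
  have det: "\<bar>det (matrix (f' v))\<bar> = (1 - (cmod \<beta>)^2) * (cmod (g' (e v)))^2" for v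
  proof -
    have "det (matrix (f' v)) = (1 - (cmod \<beta>)^2) * (cmod (g' (e v)))^2"
      using det_conformal_twist[of "g' (e v)" \<beta>] by (simp only: f'_def[abs_def] e'_def T_def e_def Let_def)
    moreover have "(cmod \<beta>)^2 \<le> 1" using beta by (simp add: power_le_one)
    ultimately show ?thesis by simp
  qed
  have cont': "continuous_on (cbox a b) (\<lambda>v. (cmod (g' (e v)))^2)"
    by (intro continuous_intros continuous_on_compose2[OF cont] linear_continuous_on e) (auto simp: cbox e_def)
  then have int: "(\<lambda>v. (1 - (cmod \<beta>)^2) * (cmod (g' (e v)))^2) integrable_on cbox a b"
    by (intro integrable_continuous continuous_on_mult[OF continuous_on_const])
  then have "measure lebesgue (f ` box a b) = integral (box a b) (\<lambda>v. (1 - (cmod \<beta>)^2) * (cmod (g' (e v)))^2)"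
    using measure_differentiable_image_eq[OF _ der_f \<open>inj_on f (box a b)\<close>]
    by (simp add: det integrable_on_open_interval)
  also have "\<dots> = (1 - (cmod \<beta>)^2) * integral (cbox a b) (\<lambda>v. (cmod (g' (e v)))^2)"
    by (simp add: integral_open_interval)
  also have "integral (cbox a b) (\<lambda>v. (cmod (g' (e v)))^2)
     = integral {a$1..b$1} (\<lambda>x. integral {a$2..b$2} (\<lambda>y. (cmod (g' (Complex x y)))^2))"
    by (simp add: integral_real2_iterated[OF cont']) (simp add: e_def)
  finally have "(1 - (cmod \<beta>)^2) * integral {a$1..b$1} (\<lambda>x. integral {a$2..b$2} (\<lambda>y. (cmod (g' (Complex x y)))^2))
      = measure lebesgue (f ` box a b)" by simp
  also have "\<dots> \<le> measure lebesgue (cball (0::real^2) R)"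
  proof (rule measure_mono_fmeasurable)
    have "norm (e' z) = cmod z" for z
      by (simp add: norm_vec_def L2_set_def e'_def cmod_def UNIV_2)
    then show "f ` box a b \<subseteq> cball 0 R"
      using bound by (auto simp: box f_def e_def T_def)
    show "f ` box a b \<in> sets lebesgue"
      using measurable_differentiable_image_eq[OF _ der_f \<open>inj_on f (box a b)\<close>] int
      by (simp add: det integrable_on_open_interval fmeasurableD)
  qed auto
  also have "\<dots> = pi * R^2"
    using R by (simp add: content_cball unit_ball_vol_2)
  finally show ?thesis .
qed

section \<open>The area theorem\<close>

text \<open>Composing with \<open>exp\<close> turns the annulus, slit along the positive real axis,
  into a rectangle. The derivative becomes \<open>p / exp\<close> with
  \<open>p z = z h' z - h z\<close>, whose coefficients are \<open>(k - 1) H_k\<close>. Bessel's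
  inequality for \<open>p\<close> on each circle, integrated over the logarithm of the radius,
  bounds the area from below by the finite sum; the enclosing ellipse bounds it from above.\<close>

lemma annulus_area_le:
  assumes hol: "h holomorphic_on ball 0 1" and H: "h has_fps_expansion H" and h0: "h 0 \<noteq> 0"
    and inj: "inj_on (\<lambda>z. h z / z) (ball 0 1 - {0})"
    and sr: "0 < s" "s < r" "r < 1" and beta: "cmod \<beta> < 1"
    and circ: "\<And>z. cmod z = s \<Longrightarrow> cmod (h z / z - \<beta> * cnj (h z / z)) \<le> R"
  shows "(1 - (cmod \<beta>)\<^sup>2) * (\<Sum>k\<le>M. (real k - 1) * (cmod (fps_nth H k))\<^sup>2 *
           (r powr (2 * (real k - 1)) - s powr (2 * (real k - 1)))) \<le> R\<^sup>2"
proof -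
  define p where "p z = z * deriv h z - h z" for z
  define P where "P = fps_X * fps_deriv H - H"
  define a b :: "real^2" where "a = vector [ln s, 0]" and "b = vector [ln r, 2 * pi]"
  define g where "g z = h (exp z) / exp z" for z
  define g' where "g' z = p (exp z) / exp z" for z
  have Pk: "fps_nth P k = of_real (real k - 1) * fps_nth H k" for k
    by (cases k) (auto simp: P_def algebra_simps)
  have P: "p has_fps_expansion P"
    unfolding p_def P_def by (intro fps_expansion_intros H)
  have pol: "p holomorphic_on ball 0 1"
    unfolding p_def by (intro holomorphic_intros hol holomorphic_deriv[OF hol]) auto
  let ?K = "{z. a$1 \<le> Re z \<and> Re z \<le> b$1 \<and> a$2 \<le> Im z \<and> Im z \<le> b$2}"
  let ?U = "{z. a$1 < Re z \<and> Re z < b$1 \<and> a$2 < Im z \<and> Im z < b$2}"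
  have exp_le: "exp (Re z) \<le> r" if "z \<in> ?K" for z
    using that sr by (metis (mono_tags, lifting) b_def exp_le_cancel_iff exp_ln less_trans mem_Collect_eq vector_2(1))
  have ball: "exp z \<in> ball 0 1" if "z \<in> ?K" for z
  proof -
    have "exp (Re z) < 1" using exp_le[OF that] sr by linarith
    then show ?thesis by simp
  qed
  have "(g has_field_derivative g' z) (at z)" if "z \<in> ?K" for z
  proof -
    have "(h has_field_derivative deriv h (exp z)) (at (exp z))"
      using ball[OF that] by (intro holomorphic_derivI[OF hol]) auto
    from DERIV_chain2[OF this DERIV_exp]
    have "(g has_field_derivative (deriv h (exp z) * exp z * exp z - h (exp z) * exp z) / (exp z * exp z)) (at z)"
      unfolding g_def by (intro derivative_eq_intros) auto
    moreover have "(d * e * e - c * e) / (e * e) = (e * d - c) / e" if "e \<noteq> 0" for c d e :: complex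
      using that by (simp add: field_simps)
    ultimately show ?thesis by (simp add: g'_def p_def)
  qed
  moreover have "continuous_on ?K g'"
    unfolding g'_def using ball
    by (intro continuous_intros continuous_on_compose2[OF holomorphic_on_imp_continuous_on[OF pol]]) auto
  moreover have "inj_on g ?U"
  proof (rule inj_onI)
    fix x y assume xy: "x \<in> ?U" "y \<in> ?U" "g x = g y"
    then have "exp x \<in> ball 0 1 - {0}" "exp y \<in> ball 0 1 - {0}"
      using ball[of x] ball[of y] by auto
    with xy have "exp x = exp y" by (auto simp: g_def dest: inj_onD[OF inj])
    moreover have "\<bar>Im x - Im y\<bar> < 2 * pi" using xy by (auto simp: a_def b_def)
    ultimately show "x = y" by (metis exp_complex_eqI)
  qed
  moreover have "cmod (g z - \<beta> * cnj (g z)) \<le> R" if "z \<in> ?U" for z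
    unfolding g_def
  proof (rule annulus_image_in_ellipse[OF hol h0 inj])
    have "s < exp (Re z)" using that sr
      by (metis (mono_tags, lifting) a_def exp_less_cancel_iff exp_ln mem_Collect_eq vector_2(1))
    then show "s < cmod (exp z)" by simp
    show "cmod (exp z) < 1" using ball[of z] that by simp
  qed (use sr circ in auto)
  moreover have "R \<ge> 0" using circ[of "of_real s"] sr by (auto intro: order_trans[OF norm_ge_zero])
  ultimately have "(1 - (cmod \<beta>)^2) * integral {a$1..b$1} (\<lambda>x. integral {a$2..b$2} (\<lambda>y. (cmod (g' (Complex x y)))^2)) \<le> pi * R^2"
    using beta by (intro measure_twisted_image) auto
  then have area: "(1 - (cmod \<beta>)^2) * integral {ln s..ln r} (\<lambda>x. integral {0..2*pi} (\<lambda>y. (cmod (g' (Complex x y)))^2)) \<le> pi * R^2"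
    by (simp add: a_def b_def)
  \<comment> \<open>\<open>pi * A k\<close> is an antiderivative of \<open>2 pi (k - 1) A k\<close>,
    the contribution of index \<open>k\<close> on the circle of radius \<open>exp x\<close>. The
    index \<open>k = 1\<close> contributes 0, so no logarithm arises.\<close>
  define A where "A k x = (real k - 1) * (cmod (fps_nth H k))\<^sup>2 * exp (2 * (real k - 1) * x)" for k x
  have "((\<lambda>x. \<Sum>k\<le>M. 2 * pi * ((real k - 1) * A k x)) has_integral (\<Sum>k\<le>M. pi * A k (ln r)) - (\<Sum>k\<le>M. pi * A k (ln s))) {ln s..ln r}"
    using sr unfolding A_def
    by (intro fundamental_theorem_of_calculus)
      (auto intro!: derivative_eq_intros sum.cong simp flip: has_real_derivative_iff_has_vector_derivative)
  moreover have "(\<lambda>x. integral {0..2*pi} (\<lambda>y. (cmod (g' (Complex x y)))^2)) integrable_on {ln s..ln r}"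
  proof (rule integrable_continuous_real)
    have "continuous_on ({ln s..ln r} \<times> cbox 0 (2*pi)) (\<lambda>q. g' (Complex (fst q) (snd q)))"
      by (rule continuous_on_compose2[OF \<open>continuous_on ?K g'\<close>])
         (auto intro!: continuous_intros simp: a_def b_def Complex_eq)
    then have "continuous_on ({ln s..ln r} \<times> cbox 0 (2*pi)) (\<lambda>(x, y). (cmod (g' (Complex x y)))^2)"
      by (auto simp: case_prod_unfold intro!: continuous_intros)
    from integral_continuous_on_param[OF this]
    show "continuous_on {ln s..ln r} (\<lambda>x. integral {0..2*pi} (\<lambda>y. (cmod (g' (Complex x y)))^2))" by simp
  qed
  moreover have "(\<Sum>k\<le>M. 2 * pi * ((real k - 1) * A k x)) \<le> integral {0..2*pi} (\<lambda>y. (cmod (g' (Complex x y)))^2)"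
    if "x \<in> {ln s..ln r}" for x
  proof -
    have x: "0 < exp x" "exp x < 1"
      using that sr by (auto intro: order.strict_trans1[of x "ln r"] simp: ln_less_zero)
    have "(\<Sum>k\<le>M. 2 * pi * ((real k - 1) * A k x)) = exp (-2 * x) * (2 * pi * (\<Sum>k\<le>M. (cmod (fps_nth P k))\<^sup>2 * exp x ^ (2*k)))"
      unfolding sum_distrib_left
    proof (intro sum.cong refl)
      fix k
      have "exp (2 * (real k - 1) * x) = exp (-2 * x) * exp x ^ (2*k)"
        by (simp add: exp_of_nat_mult[symmetric] exp_add[symmetric] algebra_simps)
      then show "2 * pi * ((real k - 1) * A k x) = exp (-2 * x) * (2 * pi * ((cmod (fps_nth P k))\<^sup>2 * exp x ^ (2*k)))"
        by (simp add: A_def Pk norm_mult power_mult_distrib power2_eq_square del: of_real_diff)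
    qed
    also have "\<dots> \<le> exp (-2 * x) * integral {0..2*pi} (\<lambda>t. (cmod (p (of_real (exp x) * cis t)))\<^sup>2)"
      by (intro mult_left_mono Bessel_circle[OF pol P] x) auto
    also have "\<dots> = integral {0..2*pi} (\<lambda>t. exp (-2 * x) * (cmod (p (of_real (exp x) * cis t)))\<^sup>2)"
      by simp
    also have "(\<lambda>t. exp (-2 * x) * (cmod (p (of_real (exp x) * cis t)))\<^sup>2) = (\<lambda>y. (cmod (g' (Complex x y)))^2)"
    proof
      fix y
      have "exp (Complex x y) = of_real (exp x) * cis y"
        by (simp add: exp_eq_polar exp_of_real)
      moreover have "exp (-2 * x) = 1 / (exp x)\<^sup>2" by (simp add: exp_minus power2_eq_square exp_add[symmetric] field_simps)
      ultimately show "exp (-2 * x) * (cmod (p (of_real (exp x) * cis y)))\<^sup>2 = (cmod (g' (Complex x y)))^2"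
        by (simp add: g'_def norm_divide norm_mult power_divide)
    qed
    finally show ?thesis .
  qed
  ultimately have "(\<Sum>k\<le>M. pi * A k (ln r)) - (\<Sum>k\<le>M. pi * A k (ln s)) \<le> integral {ln s..ln r} (\<lambda>x. integral {0..2*pi} (\<lambda>y. (cmod (g' (Complex x y)))^2))"
    by (rule has_integral_le[OF _ integrable_integral])
  also have "(\<Sum>k\<le>M. pi * A k (ln r)) - (\<Sum>k\<le>M. pi * A k (ln s)) = pi * (\<Sum>k\<le>M. (real k - 1) * (cmod (fps_nth H k))\<^sup>2 *
           (r powr (2 * (real k - 1)) - s powr (2 * (real k - 1))))"
    unfolding sum_distrib_left sum_subtractf[symmetric] A_def using sr
    by (intro sum.cong refl) (simp add: powr_def algebra_simps)
  finally have "(1 - (cmod \<beta>)^2) * (pi * (\<Sum>k\<le>M. (real k - 1) * (cmod (fps_nth H k))\<^sup>2 *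
           (r powr (2 * (real k - 1)) - s powr (2 * (real k - 1))))) \<le> pi * R^2"
    using beta by (intro order_trans[OF mult_left_mono area]) (auto simp: power_le_one)
  then have "pi * ((1 - (cmod \<beta>)^2) * (\<Sum>k\<le>M. (real k - 1) * (cmod (fps_nth H k))\<^sup>2 *
           (r powr (2 * (real k - 1)) - s powr (2 * (real k - 1))))) \<le> pi * R^2" by (simp add: mult_ac)
  then show ?thesis by simp
qed

text \<open>\<open>fps_nth H (n + 2)\<close> is the coefficient of \<open>z ^ (n + 1)\<close> in
  \<open>h z / z\<close>, which explains the weight \<open>n + 1\<close>. Letting the inner radius
  \<open>s\<close> tend to 0 in \<open>annulus_area_le\<close> gives
  \<open>S r \<le> 1 / r^2\<close>; then \<open>r\<close> tends to 1.\<close>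

lemma area_theorem:
  assumes hol: "h holomorphic_on ball 0 1" and F: "h has_fps_expansion H"
    and H: "fps_nth H 0 = 1" "fps_nth H 1 = 0"
    and inj: "inj_on (\<lambda>z. h z / z) (ball 0 1 - {0})"
  shows "(\<Sum>n\<le>N. (real n + 1) * (cmod (fps_nth H (n + 2)))\<^sup>2) \<le> 1"
proof -
  define S where "S x = (\<Sum>n\<le>N. (real n + 1) * (cmod (fps_nth H (n + 2)))\<^sup>2 * x ^ (2 * n + 2))" for x :: real
  define B where "B = cmod (fps_nth H 2)"
  have h0: "h 0 \<noteq> 0"
    using has_fps_expansion_imp_0_eq_fps_nth_0[OF F] H by simp
  obtain C \<delta> where \<delta>: "0 < \<delta>"
    and C: "\<And>z. 0 < cmod z \<Longrightarrow> cmod z < \<delta> \<Longrightarrow>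
       cmod (h z / z - fps_nth H 2 * (cmod z)\<^sup>2 * cnj (h z / z)) \<le> 1 / cmod z + C * (cmod z)\<^sup>2"
    using circle_image_bound[OF F H] by blast
  have contS: "(S \<longlongrightarrow> S a) (at a within A)" for a A
    unfolding S_def by (intro tendsto_intros)
  \<comment> \<open>The squared radius \<open>(1/s + C s^2)^2\<close> and the index 0 term both blow
    up like \<open>1/s^2\<close>. These parts are cancelled before the limit; the remaining
    right-hand side \<open>2 C s + C^2 s^4 + B^2 s^2\<close> tends to 0.\<close>
  have le_r: "S r - 1 / r\<^sup>2 \<le> 0" if r: "0 < r" "r < 1" for r
  proof (rule tendsto_le)
    show "((\<lambda>s. (1 - (B * s\<^sup>2)\<^sup>2) * (S r - 1 / r\<^sup>2 - S s)) \<longlongrightarrow> S r - 1 / r\<^sup>2) (at_right 0)"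
      by (rule tendsto_eq_intros contS refl | simp add: S_def)+
    show "((\<lambda>s. 2 * C * s + C\<^sup>2 * s ^ 4 + B\<^sup>2 * s\<^sup>2) \<longlongrightarrow> 0) (at_right 0)"
      by (rule tendsto_eq_intros refl | simp)+
    have "((\<lambda>s. B * s\<^sup>2) \<longlongrightarrow> 0) (at_right 0)"
      by (rule tendsto_eq_intros refl | simp)+
    then have "\<forall>\<^sub>F s in at_right 0. B * s\<^sup>2 < 1" by (rule order_tendstoD) simp
    moreover have "\<forall>\<^sub>F s in at_right 0. s \<in> {0<..<min \<delta> r}"
      using \<delta> r by (intro eventually_at_rightI[of _ "min \<delta> r"]) auto
    ultimately show "\<forall>\<^sub>F s in at_right 0. (1 - (B * s\<^sup>2)\<^sup>2) * (S r - 1 / r\<^sup>2 - S s)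
        \<le> 2 * C * s + C\<^sup>2 * s ^ 4 + B\<^sup>2 * s\<^sup>2"
    proof eventually_elim
      case (elim s)
      then have s: "0 < s" "s < \<delta>" "s < r" by auto
      define \<beta> where "\<beta> = fps_nth H 2 * s\<^sup>2"
      have \<beta>: "cmod \<beta> = B * s\<^sup>2" by (simp add: \<beta>_def B_def norm_mult norm_power)
      \<comment> \<open>Index 0 yields the polar part \<open>- 1 / x^2\<close>, index 1 vanishes,
        and the indices from 2 on, shifted by two, form \<open>S x\<close>.\<close>
      define f where "f x k = (real k - 1) * (cmod (fps_nth H k))\<^sup>2 * x powr (2 * (real k - 1))" for x k
      have f: "(\<Sum>k\<le>Suc (Suc N). f x k) = S x - 1 / x\<^sup>2" if "x > 0" for x
      proof -
        have "f x 0 = - (1 / x\<^sup>2)" using that H by (simp add: f_def powr_minus powr_numeral divide_inverse)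
        moreover have "f x 1 = 0" by (simp add: f_def)
        moreover have "f x (Suc (Suc n)) = (real n + 1) * (cmod (fps_nth H (n + 2)))\<^sup>2 * x ^ (2 * n + 2)" for n
          using that powr_realpow[of x "2 * n + 2"] by (simp add: f_def algebra_simps)
        ultimately show ?thesis
          by (simp add: sum.atMost_Suc_shift[of _ "Suc N"] sum.atMost_Suc_shift[of _ N] S_def del: sum.atMost_Suc)
      qed
      have "(1 - (cmod \<beta>)\<^sup>2) * (\<Sum>k\<le>Suc (Suc N). (real k - 1) * (cmod (fps_nth H k))\<^sup>2 *
           (r powr (2 * (real k - 1)) - s powr (2 * (real k - 1)))) \<le> (1 / s + C * s\<^sup>2)\<^sup>2"
      proof (rule annulus_area_le[OF hol F h0 inj])
        show "cmod \<beta> < 1" using elim \<beta> by simp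
        show "cmod (h z / z - \<beta> * cnj (h z / z)) \<le> 1 / s + C * s\<^sup>2" if "cmod z = s" for z
          using C[of z] s that by (simp add: \<beta>_def)
      qed (use s r in auto)
      moreover have "(\<Sum>k\<le>Suc (Suc N). (real k - 1) * (cmod (fps_nth H k))\<^sup>2 *
           (r powr (2 * (real k - 1)) - s powr (2 * (real k - 1)))) = (S r - 1 / r\<^sup>2) - (S s - 1 / s\<^sup>2)"
        using f[OF \<open>0 < r\<close>] f[OF \<open>0 < s\<close>] by (simp only: f_def right_diff_distrib sum_subtractf)
      ultimately have "(1 - (B * s\<^sup>2)\<^sup>2) * ((S r - 1 / r\<^sup>2) - (S s - 1 / s\<^sup>2)) \<le> (1 / s + C * s\<^sup>2)\<^sup>2"
        by (simp only: \<beta>)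
      moreover have "(1 / s + C * s\<^sup>2)\<^sup>2 = 1 / s\<^sup>2 + 2 * C * s + C\<^sup>2 * s ^ 4"
        using s by (simp add: field_simps power2_eq_square power4_eq_xxxx)
      moreover have "(1 - (B * s\<^sup>2)\<^sup>2) * ((S r - 1 / r\<^sup>2) - (S s - 1 / s\<^sup>2))
         = (1 - (B * s\<^sup>2)\<^sup>2) * (S r - 1 / r\<^sup>2 - S s) + (1 / s\<^sup>2 - B\<^sup>2 * s\<^sup>2)"
      proof -
        have "(1 - (B * s\<^sup>2)\<^sup>2) * (1 / s\<^sup>2) = 1 / s\<^sup>2 - B\<^sup>2 * s\<^sup>2"
          using s by (simp add: field_simps power2_eq_square)
        then show ?thesis by (simp only: right_diff_distrib)
      qed
      ultimately show ?case by linarith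
    qed
  qed simp
  have "S 1 - 1 \<le> 0"
  proof (rule tendsto_le)
    show "((\<lambda>r. S r - 1 / r\<^sup>2) \<longlongrightarrow> S 1 - 1) (at_left 1)"
      by (rule tendsto_eq_intros contS refl | simp)+
    show "\<forall>\<^sub>F r in at_left 1. S r - 1 / r\<^sup>2 \<le> 0"
      using le_r by (intro eventually_at_leftI[of 0]) auto
  qed auto
  then show ?thesis by (simp add: S_def)
qed

section \<open>The extremal problem for the coefficients\<close>

text \<open>Completing squares in \<open>e\<close>, \<open>d\<close> and \<open>b\<close> with a
  common multiplier \<open>m\<close> replaces them by \<open>m (1 - A)\<close> through the
  constraint. What remains is a rational inequality in the single variable \<open>A\<close> on
  \<open>[0, 1]\<close>.\<close>

lemma coefficient_functional_le:
  fixes a b d e :: real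
  assumes "a \<ge> 0" "b \<ge> 0" "d \<ge> 0" "e \<ge> 0" and c: "a^2 + 3*b^2 + 5*d^2 + 7*e^2 \<le> 1"
  shows "2*e + 4*a*d + 3*b^2 + 6*a^2*b + a^4 \<le> 2.32979"
proof -
  define A where "A = a^2"
  have A: "0 \<le> A" "A \<le> 1" using c by (auto simp: A_def intro: order_trans[rotated])
  \<comment> \<open>m is a Lagrange multiplier for the constraint; as a function of A it is a rational
    approximation, good near A = 0.685, of the optimal one.\<close>
  define u v where "u = 4 - 2*A" and "v = 4 + 7*A"
  have uv: "u > 0" "v > 0" using A by (auto simp: u_def v_def)
  define m where "m = v/u"
  have m: "m > 0" using uv by (simp add: m_def)
  have s1: "2*e \<le> 7*m*e^2 + 1/(7*m)"
  proof -
    have "0 \<le> 7*m*(e - 1/(7*m))^2" using m by simp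
    also have "\<dots> = 7*m*e^2 - 2*e + 1/(7*m)" using m by (simp add: power2_eq_square field_simps)
    finally show ?thesis by simp
  qed
  have s2: "4*a*d \<le> 5*m*d^2 + 4*A/(5*m)"
  proof -
    have "0 \<le> 5*m*(d - 2*a/(5*m))^2" using m by simp
    also have "\<dots> = 5*m*d^2 - 4*a*d + 4*A/(5*m)" using m by (simp add: A_def power2_eq_square field_simps)
    finally show ?thesis by simp
  qed
  \<comment> \<open>Completing the square costs \<open>3 A^2 / (m - 1)\<close>. Because
    \<open>m - 1 = 9 A / u\<close>, this is the polynomial \<open>A u / 3\<close>, with no
    singularity at \<open>A = 0\<close>.\<close>
  have s3: "6*A*b \<le> 3*(m-1)*b^2 + A*u/3"
  proof -
    have "m - 1 = 9*A/u" using uv by (simp add: m_def u_def v_def field_simps)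
    then have "3*(m-1)*b^2 + A*u/3 - 6*A*b = 3*(9*A/u)*b^2 + A*u/3 - 6*A*b" by (simp only:)
    also have "\<dots> = A*(9*b - u)^2/(3*u)"
      using uv by (simp add: power2_eq_square field_simps)
    finally have "3*(m-1)*b^2 + A*u/3 - 6*A*b = A*(9*b - u)^2/(3*u)" .
    moreover have "0 \<le> A*(9*b - u)^2/(3*u)" using uv A by simp
    ultimately show ?thesis by linarith
  qed
  have "m*(5*d^2 + 7*e^2 + 3*b^2) \<le> m*(1-A)" using c m by (intro mult_left_mono) (auto simp: A_def)
  then have "2*e + 4*a*d + 3*b^2 + 6*a^2*b + a^4 \<le> m*(1-A) + (1/7 + 4*A/5)/m + A^2 + A*u/3"
    using s1 s2 s3 by (simp add: algebra_simps A_def add_divide_distrib)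
  also have "\<dots> = (v^2*(1-A) + (1/7 + 4*A/5)*u^2 + (A^2 + A*u/3)*u * v)/(u * v)"
    using uv by (simp add: m_def power2_eq_square field_simps)
  also have "\<dots> \<le> 2.32979"
  proof -
    have "v^2*(1-A) + (1/7 + 4*A/5)*u^2 + (A^2 + A*u/3)*u * v \<le> 2.32979 * (u * v)"
    proof -
      \<comment> \<open>Division of the quartic by \<open>(A - 0.6854)^2\<close>, with 0.6854 close
        to its minimiser. The quotient has positive coefficients, and the linear remainder is
        positive on \<open>[0, 1]\<close>.\<close>
      have "2.32979 * (u * v) - (v^2*(1-A) + (1/7 + 4*A/5)*u^2 + (A^2 + A*u/3)*u * v)
        = (A - 0.6854)^2 * (14/3*A^2 + 240739/3750*A + 3536800371/87500000)
          + (757547950563/312500000000000 - 21137373/15625000000*A)"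
        by (simp add: u_def v_def field_simps power2_eq_square)
      moreover have "0 \<le> (A - 0.6854)^2 * (14/3*A^2 + 240739/3750*A + 3536800371/87500000)"
        using A by simp
      ultimately show ?thesis using A by linarith
    qed
    then show ?thesis using uv by (simp add: divide_le_eq)
  qed
  finally show ?thesis .
qed
text \<open>Comparing coefficients in \<open>F * G^2 = fps_X\<close> determines those of
  \<open>F\<close> recursively. Adding \<open>c 1\<close> times the fourth to the fifth partly
  cancels: the coefficients of \<open>c 1 * c 3\<close>, \<open>c 1 ^ 2 * c 2\<close> and
  \<open>c 1 ^ 4\<close> drop from 6, -12, 5 to 4, -6, 1.\<close>

lemma fps_nth_of_mult_square_eq_X:
  fixes F G :: "complex fps"
  assumes "F * G^2 = fps_X" "fps_nth G 0 = 1" "fps_nth F 0 = 0" 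
  defines "c \<equiv> fps_nth G"
  shows "fps_nth F 5 + c 1 * fps_nth F 4 = -2*c 4 + 4*c 1*c 3 + 3*(c 2)^2 - 6*(c 1)^2*c 2 + (c 1)^4"
proof -
  have e: "(\<Sum>i=0..n. fps_nth F i * (\<Sum>j=0..n-i. fps_nth G j * fps_nth G (n-i-j))) = fps_nth fps_X n" for n
    using assms(1) by (metis (no_types, lifting) fps_mult_nth power2_eq_square sum.cong)
  define c1 c2 c3 c4 a1 a2 a3 a4 a5 where d: "c1 = fps_nth G 1" "c2 = fps_nth G 2" "c3 = fps_nth G 3" "c4 = fps_nth G 4"
     "a1 = fps_nth F 1" "a2 = fps_nth F 2" "a3 = fps_nth F 3" "a4 = fps_nth F 4" "a5 = fps_nth F 5"
  note d' = d[unfolded numeral_nat One_nat_def, symmetric]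
  note n = e[of "Suc 0", simplified, unfolded d' assms] 
     e[of "Suc (Suc 0)", simplified, unfolded d' assms]
     e[of "Suc (Suc (Suc 0))", simplified, unfolded d' assms]
     e[of "Suc (Suc (Suc (Suc 0)))", simplified, unfolded d' assms]
     e[of "Suc (Suc (Suc (Suc (Suc 0))))", simplified, unfolded d' assms]
  have "a1 = 1" using n(1) by simp
  moreover have "a2 = -2*c1" using n(2) unfolding \<open>a1 = 1\<close> by algebra
  moreover have "a3 = 3*c1^2 - 2*c2" using n(3) unfolding calculation by algebra
  moreover have "a4 = 6*c1*c2 - 4*c1^3 - 2*c3" using n(4) unfolding calculation by algebra
  moreover have "a5 = 5*c1^4 - 12*c1^2*c2 + 3*c2^2 + 6*c1*c3 - 2*c4" using n(5) unfolding calculation by algebra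
  ultimately show ?thesis unfolding c_def d[symmetric] by algebra
qed

text \<open>Univalence makes \<open>f z / z\<close> free of zeros, so its reciprocal has a
  holomorphic square root \<open>g\<close>. Since \<open>f (z^2) (g (z^2) / z)^2 = 1\<close>, equal
  values of \<open>g (z^2) / z\<close> force equal \<open>f (z^2)\<close>, hence equal
  \<open>z^2\<close>; the sign is then decided because \<open>g (z^2) / z\<close> is odd and
  nonzero.\<close>

lemma class_S_square_root_transform:
  assumes "f \<in> class_S"
  obtains g where "g holomorphic_on ball 0 1" "g 0 = 1" "\<And>z. z \<in> ball 0 1 \<Longrightarrow> f z * (g z)\<^sup>2 = z"
    and "inj_on (\<lambda>z. g (z\<^sup>2) / z) (ball 0 1 - {0})"
proof -
  have f: "f holomorphic_on ball 0 1" "inj_on f (ball 0 1)" "f 0 = 0" "deriv f 0 = 1"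
    using assms by (auto simp: class_S_def)
  define q where "q z = (if z = 0 then deriv f 0 else (f z - f 0) / (z - 0))" for z
  have q: "q holomorphic_on ball 0 1"
    unfolding q_def by (intro pole_lemma_open f) auto
  have qf: "f z = z * q z" for z using f by (simp add: q_def)
  have q_nz: "q z \<noteq> 0" if "z \<in> ball 0 1" for z
    using inj_onD[OF f(2), of z 0] that f by (auto simp: q_def)
  have q': "(\<lambda>z. inverse (q z)) holomorphic_on ball 0 1"
    using q q_nz by (intro holomorphic_intros) auto
  obtain k where k: "k holomorphic_on ball 0 1" "\<And>z. z \<in> ball 0 1 \<Longrightarrow> inverse (q z) = k z ^ 2"
    by (rule contractible_imp_holomorphic_sqrt[OF q']) (use q_nz convex_imp_contractible in auto)
  have k0: "(k 0)\<^sup>2 = 1" using k(2)[of 0] f by (simp add: q_def)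
  \<comment> \<open>\<open>k 0\<close> is 1 or -1, so this factor selects the branch with value 1 at
    0.\<close>
  define g where "g z = k 0 * k z" for z
  have hol: "g holomorphic_on ball 0 1" unfolding g_def by (intro holomorphic_intros k)
  have eq: "f z * (g z)\<^sup>2 = z" if "z \<in> ball 0 1" for z
    using k(2)[OF that] q_nz[OF that] k0 by (simp add: qf g_def power_mult_distrib flip: k(2)[OF that])
  show thesis
  proof
    show "g 0 = 1" using k0 by (simp add: g_def power2_eq_square)
    show "inj_on (\<lambda>z. g (z\<^sup>2) / z) (ball 0 1 - {0})"
    proof (rule inj_onI)
      fix x y assume xy: "x \<in> ball 0 1 - {0}" "y \<in> ball 0 1 - {0}" "g (x\<^sup>2) / x = g (y\<^sup>2) / y"
      have sq: "z\<^sup>2 \<in> ball 0 1" "f (z\<^sup>2) * (g (z\<^sup>2) / z)\<^sup>2 = 1" if "z \<in> ball 0 1 - {0}" for z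
      proof -
        show "z\<^sup>2 \<in> ball 0 1" using that by (simp add: norm_power power_less_one_iff)
        from eq[OF this] show "f (z\<^sup>2) * (g (z\<^sup>2) / z)\<^sup>2 = 1"
          using that by (simp add: power_divide)
      qed
      have "f (x\<^sup>2) = f (y\<^sup>2)"
        using sq(2)[OF xy(1)] sq(2)[OF xy(2)] xy(3) by (metis mult_right_cancel mult_zero_right zero_neq_one)
      then have xy2: "x\<^sup>2 = y\<^sup>2" using inj_onD[OF f(2)] sq(1)[OF xy(1)] sq(1)[OF xy(2)] by blast
      moreover have "g (x\<^sup>2) \<noteq> 0" using sq(2)[OF xy(1)] by auto
      ultimately show "x = y" using xy by (auto simp: power2_eq_iff)
    qed
  qed (use hol eq in auto)
qed

(* The bound 2.3297... is a constant, independent of f, known through its truncated decimal expansion. *)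
theorem theorem2:
  shows "\<exists>c::real. 2.3297 \<le> c \<and> c < 2.3298 \<and>
    (\<forall>f\<in>class_S. cmod (taylor_coeff f 5) - cmod (taylor_coeff f 4) \<le> c)"
proof (intro exI[of _ "2.32979"] conjI ballI)
  fix f assume f: "f \<in> class_S"
  from f obtain g where g: "g holomorphic_on ball 0 1" "g 0 = 1" 
    "\<And>z. z \<in> ball 0 1 \<Longrightarrow> f z * (g z)\<^sup>2 = z" "inj_on (\<lambda>z. g (z\<^sup>2) / z) (ball 0 1 - {0})"
    using class_S_square_root_transform by blast
  have f': "f holomorphic_on ball 0 1" "f 0 = 0" using f by (auto simp: class_S_def)
  define F G where "F = fps_expansion f 0" and "G = fps_expansion g 0"
  have F: "f has_fps_expansion F" unfolding F_def using f' by (intro has_fps_expansion_fps_expansion[of "ball 0 1"]) auto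
  have G: "g has_fps_expansion G" unfolding G_def using g by (intro has_fps_expansion_fps_expansion[of "ball 0 1"]) auto
  define H where "H = G oo fps_X\<^sup>2"
  have Hn: "fps_nth H n = (if 2 dvd n then fps_nth G (n div 2) else 0)" for n
    unfolding H_def by (rule fps_nth_compose_X_power)
  have "(g \<circ> (\<lambda>z. z\<^sup>2)) has_fps_expansion H"
    unfolding H_def by (intro has_fps_expansion_compose G fps_expansion_intros) auto
  then have H: "(\<lambda>z. g (z\<^sup>2)) has_fps_expansion H" by (simp add: o_def)
  have G0: "fps_nth G 0 = 1" and F0: "fps_nth F 0 = 0"
    using has_fps_expansion_imp_0_eq_fps_nth_0[OF G] has_fps_expansion_imp_0_eq_fps_nth_0[OF F] f' g by auto
  have "(\<lambda>z. f z * (g z)\<^sup>2) has_fps_expansion F * G\<^sup>2" by (intro fps_expansion_intros F G)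
  moreover have ev: "\<forall>\<^sub>F z in nhds 0. f z * (g z)\<^sup>2 = z"
    using g(3) by (intro eventually_nhds_in_open[THEN eventually_mono, of "ball 0 1"]) auto
  ultimately have "(\<lambda>z. z) has_fps_expansion F * G\<^sup>2"
    by (simp only: has_fps_expansion_cong[OF ev refl])
  then have FG: "F * G\<^sup>2 = fps_X"
    using fps_expansion_eqI has_fps_expansion_fps_X by metis
  define a b d e where "a = cmod (fps_nth G 1)" and "b = cmod (fps_nth G 2)"
    and "d = cmod (fps_nth G 3)" and "e = cmod (fps_nth G 4)"
  \<comment> \<open>Only even indices of \<open>H\<close> are nonzero: \<open>n = 0, 2, 4, 6\<close>
    give the coefficients 1 to 4 of \<open>G\<close> with weights 1, 3, 5, 7.\<close>
  have "(\<Sum>n\<le>6. (real n + 1) * (cmod (fps_nth H (n + 2)))\<^sup>2) \<le> 1"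
  proof (rule area_theorem[OF _ H])
    show "(\<lambda>z. g (z\<^sup>2)) holomorphic_on ball 0 1"
      by (rule holomorphic_on_compose_gen[OF _ g(1), of "\<lambda>z. z\<^sup>2", unfolded o_def])
         (auto intro!: holomorphic_intros simp: norm_power power_less_one_iff)
  qed (use g G0 in \<open>auto simp: Hn\<close>)
  moreover have six: "{..6::nat} = {0, 1, 2, 3, 4, 5, 6}" by auto
  ultimately have area: "a\<^sup>2 + 3 * b\<^sup>2 + 5 * d\<^sup>2 + 7 * e\<^sup>2 \<le> 1"
    by (simp add: six Hn a_def b_def d_def e_def)
  have "a \<le> 1"
  proof -
    have "a\<^sup>2 \<le> 1" using area by (smt (verit) zero_le_power2)
    then show ?thesis by (simp add: power2_le_iff_abs_le abs_square_le_1 a_def)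
  qed
  have "cmod (fps_nth F 5) - cmod (fps_nth F 4) \<le> cmod (fps_nth F 5) - a * cmod (fps_nth F 4)"
    using \<open>a \<le> 1\<close> by (simp add: mult_left_le_one_le a_def)
  also have "\<dots> \<le> cmod (fps_nth F 5 + fps_nth G 1 * fps_nth F 4)"
    using norm_diff_ineq[of "fps_nth F 5" "fps_nth G 1 * fps_nth F 4"] by (simp add: norm_mult a_def)
  also have "fps_nth F 5 + fps_nth G 1 * fps_nth F 4 = - 2 * fps_nth G 4 + 4 * fps_nth G 1 * fps_nth G 3
      + 3 * (fps_nth G 2)\<^sup>2 - 6 * (fps_nth G 1)\<^sup>2 * fps_nth G 2 + fps_nth G 1 ^ 4"
    by (rule fps_nth_of_mult_square_eq_X[OF FG G0 F0])
  also have "cmod \<dots> \<le> 2 * e + 4 * a * d + 3 * b\<^sup>2 + 6 * a\<^sup>2 * b + a ^ 4"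
    unfolding a_def b_def d_def e_def
    by (intro norm_triangle_le norm_triangle_le_diff order_trans[OF norm_triangle_ineq4] add_mono)
       (simp_all add: norm_mult norm_power)
  also have "\<dots> \<le> 2.32979"
    using area by (intro coefficient_functional_le) (auto simp: a_def b_def d_def e_def)
  finally show "cmod (taylor_coeff f 5) - cmod (taylor_coeff f 4) \<le> 2.32979"
    by (simp add: taylor_coeff_def F_def)
qed auto

end
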